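(* There is no finite group $G$ and integer $n\ge 4$ such that the power graph $P(G)$ is isomorphic to the torch graph $O_n$.
   Context: The power graph $P(G)$ of a finite group $G$ is the simple graph with vertex set $G$ in which two distinct vertices $u,v$ are adjacent if and only if $u\in\langle v\rangle$ or $v\in\langle u\rangle$. For $n\ge 4$, the torch graph $O_n$ is the simple graph on the $n+4$ vertices $v_1,\dots,v_{n+4}$ with exactly the following edges: $v_{n+1}v_{n+3}$; $v_{n+1}v_i$ and $v_{n+3}v_i$ for every $2\le i\le n-2$; $v_1v_{n+1}$ and $v_1v_{n+3}$; $v_1v_{n+2}$ and $v_1v_{n+4}$; $v_nv_1$, $v_nv_{n+2}$ and $v_nv_{n+4}$; and $v_nv_{n-1}$. *)

theory Defs
  imports
    "HOL-Algebra.Generated_Groups"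
    "Graph_Theory.Digraph_Isomorphism"
    "Graph_Theory.Pair_Digraph"
begin

text \<open>
  A simple graph is a \<^locale>\<open>pair_graph\<close>: a finite, loop-free digraph whose arc relation is
  symmetric, an edge \<open>uv\<close> being the two arcs \<open>(u, v)\<close> and \<open>(v, u)\<close>. For such graphs
  \<^const>\<open>digraph_iso\<close> (via \<^const>\<open>with_proj\<close>) is isomorphism of simple graphs.
  Since \<^const>\<open>digraph_iso\<close> fails for an ill-formed first argument, it is checked below that the
  graphs defined here are indeed simple graphs.
\<close>

definition power_graph :: "('a, 'b) monoid_scheme \<Rightarrow> 'a pair_pre_digraph" where
  "power_graph G = \<lparr> pverts = carrier G,
     parcs = {(u, v). u \<in> carrier G \<and> v \<in> carrier G \<and> u \<noteq> v \<and>
                      (u \<in> generate G {v} \<or> v \<in> generate G {u})} \<rparr>"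

text \<open>
  The vertex \<open>v\<^sub>i\<close> of the torch graph is the number \<open>i\<close>, and each edge is listed in one
  orientation. Natural-number subtraction is harmless here, as the torch graph is only meant
  for \<open>n \<ge> 4\<close>.
\<close>

definition torch_edges :: "nat \<Rightarrow> (nat \<times> nat) set" where
  "torch_edges n =
     {(n + 1, n + 3)}
   \<union> {(n + 1, i) | i. 2 \<le> i \<and> i \<le> n - 2} \<union> {(n + 3, i) | i. 2 \<le> i \<and> i \<le> n - 2}
   \<union> {(1, n + 1), (1, n + 3)}
   \<union> {(1, n + 2), (1, n + 4)}
   \<union> {(n, 1), (n, n + 2), (n, n + 4)}
   \<union> {(n, n - 1)}"

definition torch_graph :: "nat \<Rightarrow> nat pair_pre_digraph" where
  "torch_graph n = \<lparr> pverts = {1..n + 4}, parcs = torch_edges n \<union> (torch_edges n)\<inverse> \<rparr>"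

lemma pair_graph_power_graph:
  assumes "finite (carrier G)"
  shows "pair_graph (power_graph G)"
proof unfold_locales
  have "parcs (power_graph G) \<subseteq> carrier G \<times> carrier G"
    by (auto simp: power_graph_def)
  then show "finite (parcs (power_graph G))"
    using assms by (meson finite_SigmaI finite_subset)
  show "symmetric (with_proj (power_graph G))"
    by (auto simp: symmetric_def power_graph_def intro!: symI)
qed (use assms in \<open>auto simp: power_graph_def\<close>)

lemma pair_graph_torch_graph:
  assumes "n \<ge> 4"
  shows "pair_graph (torch_graph n)"
proof unfold_locales
  have sub: "parcs (torch_graph n) \<subseteq> {1..n + 4} \<times> {1..n + 4}"
    using assms by (auto simp: torch_graph_def torch_edges_def)
  then show "finite (parcs (torch_graph n))"
    by (meson finite_SigmaI finite_subset finite_atLeastAtMost)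
  show "\<And>e. e \<in> parcs (torch_graph n) \<Longrightarrow> fst e \<in> pverts (torch_graph n)"
    and "\<And>e. e \<in> parcs (torch_graph n) \<Longrightarrow> snd e \<in> pverts (torch_graph n)"
    using sub by (auto simp: torch_graph_def)
  show "symmetric (with_proj (torch_graph n))"
    by (simp add: symmetric_def torch_graph_def sym_Un_converse)
  show "\<And>e. e \<in> parcs (torch_graph n) \<Longrightarrow> fst e \<noteq> snd e"
    using assms by (auto simp: torch_graph_def torch_edges_def)
qed (simp add: torch_graph_def)

end

theory Submission
  imports Defs
begin

text \<open>
  The identity lies in every cyclic subgroup, so it is adjacent to every other vertex of a power
  graph. Graph isomorphisms preserve the existence of such a dominating vertex, and the torch
  graph has none: the only common neighbour of the non-adjacent vertices \<open>v\<^sub>n\<close> and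
  \<open>v\<^bsub>n+1\<^esub>\<close> is \<open>v\<^sub>1\<close>, which is not adjacent to \<open>v\<^sub>2\<close>.
\<close>

definition dominating :: "'v pair_pre_digraph \<Rightarrow> 'v \<Rightarrow> bool" where
  "dominating H d \<longleftrightarrow> d \<in> pverts H \<and> (\<forall>x \<in> pverts H. x \<noteq> d \<longrightarrow> (d, x) \<in> parcs H)"

lemma dominating_one_power_graph:
  assumes "group G"
  shows "dominating (power_graph G) \<one>\<^bsub>G\<^esub>"
  using assms
  by (auto simp: dominating_def power_graph_def group.is_monoid intro: generate.one)

lemma digraph_iso_imp_dominating:
  assumes "digraph_iso (with_proj H) (with_proj K)" and "dominating H d"
  obtains e where "dominating K e"
proof -
  obtain h where iso: "pre_digraph.digraph_isomorphism (with_proj H) h"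
    and K: "with_proj K = app_iso h (with_proj H)"
    using assms(1) by (auto simp: digraph_iso_def)
  have verts_K: "pverts K = iso_verts h ` pverts H"
    using arg_cong[OF K, of verts] by simp
  \<comment> \<open>An isomorphism maps arcs independently of vertices; as the arcs of \<open>K\<close> are pairs with the
    projections as end points, the image of an arc is the pair of the images of its ends.\<close>
  have arc_K: "(iso_verts h u, iso_verts h v) \<in> parcs K" if "(u, v) \<in> parcs H" for u v
  proof -
    have arc: "iso_arcs h (u, v) \<in> parcs K"
      using that arg_cong[OF K, of arcs] by simp
    have "iso_tail h = fst" and "iso_head h = snd"
      using arg_cong[OF K, of tail] arg_cong[OF K, of head] by simp_all
    then have "fst (iso_arcs h (u, v)) = iso_verts h u" and "snd (iso_arcs h (u, v)) = iso_verts h v"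
      using that pre_digraph.iso_verts_tail[OF iso, of "(u, v)"]
        pre_digraph.iso_verts_head[OF iso, of "(u, v)"] by simp_all
    then have "iso_arcs h (u, v) = (iso_verts h u, iso_verts h v)"
      by (simp add: prod_eq_iff)
    with arc show ?thesis by simp
  qed
  have "dominating K (iso_verts h d)"
    using assms(2) arc_K by (auto simp: dominating_def verts_K)
  then show thesis by (rule that)
qed

lemma not_dominating_torch_graph:
  assumes "n \<ge> 4"
  shows "\<not> dominating (torch_graph n) d"
proof
  assume "dominating (torch_graph n) d"
  then have adj: "d = x \<or> (d, x) \<in> torch_edges n \<union> (torch_edges n)\<inverse>" if "x \<in> {1..n + 4}" for x
    using that by (auto simp: dominating_def torch_graph_def)
  have "d = 1"
    using adj[of n] adj[of "n + 1"] assms by (auto simp: torch_edges_def)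
  then show False
    using adj[of 2] assms by (auto simp: torch_edges_def)
qed

theorem theorem3p3:
  fixes G :: "('a, 'b) monoid_scheme"
  assumes "group G" and "finite (carrier G)"
  shows "\<not> (\<exists>n::nat. n \<ge> 4 \<and>
    digraph_iso (with_proj (power_graph G)) (with_proj (torch_graph n)))"
proof
  assume "\<exists>n::nat. n \<ge> 4 \<and>
    digraph_iso (with_proj (power_graph G)) (with_proj (torch_graph n))"
  then obtain n where n: "n \<ge> 4"
    and iso: "digraph_iso (with_proj (power_graph G)) (with_proj (torch_graph n))"
    by blast
  obtain e where "dominating (torch_graph n) e"
    using digraph_iso_imp_dominating[OF iso dominating_one_power_graph[OF assms(1)]] .
  with not_dominating_torch_graph[OF n] show False by blast
qed

end
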